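(* Let $(\tau_{ij})_{i,j=1}^\infty$ be an array of centered jointly Gaussian real random variables such that for every $k\in\mathbb{N}$ $$\inf_{(a_{ij})} \mathbb{E}\Big(\tau_{kk}-\sum_{\min(i,j)<k} a_{ij}\tau_{ij}\Big)^2 = 1 .$$ For $n\in\mathbb{N}$ let $\det_n := \det(\tau_{ij})_{i,j=1}^n$. Then for any $n\in\mathbb{N}$ and any $\varepsilon>0$, $$\mathbb{P}\big(|\det\nolimits_n|\le \varepsilon\big)\le \mathbb{P}\Big(\prod_{j=1}^n |X_j|\le \varepsilon\Big),$$ where $X_1,\dots,X_n$ are i.i.d. $N(0,1)$-distributed random variables.
   Context: $\mathbb{N}=\{1,2,\dots\}$. In the infimum, $(a_{ij})$ ranges over real coefficient families indexed by the pairs $(i,j)$ of positive integers with $\min(i,j)<k$, with only finitely many nonzero coefficients, so the infimum is the squared $L^2$-distance from $\tau_{kk}$ to the closed linear span of $\{\tau_{ij}:\min(i,j)<k\}$. For $k=1$ the sum is empty, and the condition says $\mathbb{E}\tau_{11}^2=1$. "Jointly Gaussian" means that every finite linear combination is Gaussian (possibly degenerate). *)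

theory Defs
  imports "HOL-Probability.Probability" "Jordan_Normal_Form.Determinant"
begin

text \<open>Real Gaussian random variables; the second disjunct is the degenerate case of variance 0.\<close>

definition gaussian_rv :: "'a measure \<Rightarrow> ('a \<Rightarrow> real) \<Rightarrow> bool" where
  "gaussian_rv M X \<longleftrightarrow> X \<in> borel_measurable M \<and>
     (\<exists>\<mu> \<sigma>. (\<sigma> > 0 \<and> distributed M lborel X (normal_density \<mu> \<sigma>)) \<or> (AE \<omega> in M. X \<omega> = \<mu>))"

definition jointly_gaussian :: "'a measure \<Rightarrow> 'i set \<Rightarrow> ('i \<Rightarrow> 'a \<Rightarrow> real) \<Rightarrow> bool" where
  "jointly_gaussian M I X \<longleftrightarrow>
     (\<forall>F c. finite F \<longrightarrow> F \<subseteq> I \<longrightarrow> gaussian_rv M (\<lambda>\<omega>. \<Sum>i\<in>F. c i * X i \<omega>))"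

text \<open>Arrays are indexed from 1; values at index 0 are never used.\<close>

definition array_idx :: "(nat \<times> nat) set" where
  "array_idx = {(i, j). 1 \<le> i \<and> 1 \<le> j}"

definition coeff_families :: "nat \<Rightarrow> (nat \<times> nat \<Rightarrow> real) set" where
  "coeff_families k =
     {a. finite {p. a p \<noteq> 0} \<and> {p. a p \<noteq> 0} \<subseteq> {(i, j) \<in> array_idx. min i j < k}}"

text \<open>
  The sum over all pairs with \<open>min i j < k\<close> is taken over the (finite) support of the
  coefficient family.
\<close>

definition residual_variance ::
    "'a measure \<Rightarrow> (nat \<Rightarrow> nat \<Rightarrow> 'a \<Rightarrow> real) \<Rightarrow> nat \<Rightarrow> real" where
  "residual_variance M \<tau> k =
     (INF a \<in> coeff_families k.
        \<integral>\<omega>. (\<tau> k k \<omega> - (\<Sum>(i, j) \<in> {p. a p \<noteq> 0}. a (i, j) * \<tau> i j \<omega>))\<^sup>2 \<partial>M)"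

text \<open>Matrix entries in \<open>Jordan_Normal_Form\<close> are numbered from 0, hence the shift.\<close>

definition det_array ::
    "(nat \<Rightarrow> nat \<Rightarrow> 'a \<Rightarrow> real) \<Rightarrow> nat \<Rightarrow> 'a \<Rightarrow> real" where
  "det_array \<tau> n \<omega> =
     Determinant.det (Matrix.mat n n (\<lambda>(i, j). \<tau> (Suc i) (Suc j) \<omega>))"

end

theory Submission
  imports Defs
begin

text \<open>
  Expanding along the corner entry, \<open>det\<^sub>n = \<tau>\<^sub>n\<^sub>n det\<^sub>n\<^sub>-\<^sub>1 + Y\<close> where \<open>Y\<close> does not
  involve \<open>\<tau>\<^sub>n\<^sub>n\<close>.  Projecting \<open>\<tau>\<^sub>n\<^sub>n\<close> onto the span of the other entries of the \<open>n \<times> n\<close> block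
  leaves a Gaussian residual \<open>R\<close> independent of all these entries, and the hypothesis gives it
  variance at least 1.  Conditionally on the other entries, \<open>det\<^sub>n\<close> is \<open>R det\<^sub>n\<^sub>-\<^sub>1\<close> plus a constant;
  a centred interval has the largest Gaussian mass among its translates, so dropping the constant
  and shrinking the variance to 1 can only raise the probability of \<open>[- \<epsilon>, \<epsilon>]\<close>.  Induction
  on \<open>n\<close> then replaces \<open>det\<^sub>n\<^sub>-\<^sub>1\<close> by the product of the first \<open>n - 1\<close> normal variables.
\<close>

subsection \<open>Independence from characteristic functions\<close>

text \<open>For large \<open>b\<close> the function \<open>1 + W / b\<close> is a nonnegative
  density of mean one. Orthogonality says that \<open>Z\<close> has the same characteristic function
  under the tilted measure as under \<open>M\<close>, so by Levy uniqueness the same law; comparing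
  the two probabilities of \<open>B\<close> isolates the \<open>W\<close> term.\<close>

lemma (in prob_space) iexp_orthogonal_real:
  fixes W Z :: "'a \<Rightarrow> real"
  assumes [measurable]: "W \<in> borel_measurable M" "Z \<in> borel_measurable M" "B \<in> sets borel"
    and bdd: "\<And>\<omega>. \<bar>W \<omega>\<bar> \<le> c"
    and orth: "\<And>u. expectation (\<lambda>\<omega>. W \<omega> * iexp (u * Z \<omega>)) = 0"
  shows "expectation (\<lambda>\<omega>. W \<omega> * indicator B (Z \<omega>)) = 0"
proof -
  \<comment> \<open>The summand 1 keeps \<open>b\<close> positive even for \<open>c = 0\<close>, so
    that dividing by \<open>b\<close> is safe.\<close>
  define b where "b = \<bar>c\<bar> + 1"
  have b: "b > 0" by (simp add: b_def)
  define f where "f \<omega> = 1 + W \<omega> / b" for \<omega>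
  have [measurable]: "f \<in> borel_measurable M" unfolding f_def by measurable
  have Wb: "\<bar>W \<omega>\<bar> \<le> b" for \<omega> using bdd[of \<omega>] by (simp add: b_def)
  have f0: "0 \<le> f \<omega>" for \<omega>
    using Wb[of \<omega>] b by (simp add: f_def field_simps abs_le_iff)
  have intW: "integrable M W"
    by (rule integrable_const_bound[of _ b]) (use Wb in auto)
  have intf: "integrable M f" unfolding f_def using intW by simp
  \<comment> \<open>Frequency 0 of the orthogonality hypothesis gives \<open>W\<close> mean zero,
    which normalises \<open>f\<close>.\<close>
  have "complex_of_real (expectation W) = expectation (\<lambda>\<omega>. W \<omega> * iexp (0 * Z \<omega>))"
    by simp
  then have EW: "expectation W = 0" using orth[of 0] by simp
  have Ef: "expectation f = 1"
    unfolding f_def using intW EW by (simp add: prob_space)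
  define Q where "Q = density M (\<lambda>\<omega>. ennreal (f \<omega>))"
  interpret Q: prob_space Q
  proof
    show "emeasure Q (space Q) = 1"
      unfolding Q_def
      by (simp add: emeasure_density nn_integral_eq_integral[OF intf] f0 Ef cong: nn_integral_cong)
  qed
  have [measurable]: "Z \<in> borel_measurable Q" by (simp add: Q_def)
  have iW: "integrable M (\<lambda>\<omega>. W \<omega> * iexp (u * Z \<omega>))" for u
    by (rule integrable_const_bound[of _ b]) (use Wb in \<open>auto simp: norm_mult\<close>)
  have "char (distr Q borel Z) u = char (distr M borel Z) u" for u
  proof -
    have "char (distr Q borel Z) u = (\<integral>\<omega>. iexp (u * Z \<omega>) \<partial>Q)"
      by (simp add: char_def integral_distr)
    also have "\<dots> = expectation (\<lambda>\<omega>. f \<omega> *\<^sub>R iexp (u * Z \<omega>))"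
      unfolding Q_def by (intro integral_density) (auto simp: f0)
    also have "\<dots> = expectation (\<lambda>\<omega>. iexp (u * Z \<omega>) + (W \<omega> * iexp (u * Z \<omega>)) / b)"
      by (intro Bochner_Integration.integral_cong) (auto simp: f_def scaleR_conv_of_real algebra_simps)
    also have "\<dots> = expectation (\<lambda>\<omega>. iexp (u * Z \<omega>)) + expectation (\<lambda>\<omega>. W \<omega> * iexp (u * Z \<omega>)) / b"
      using iW[of u] by (subst Bochner_Integration.integral_add) (auto intro!: integrable_iexp)
    also have "\<dots> = char (distr M borel Z) u"
      by (simp add: orth char_def integral_distr del: of_real_mult)
    finally show ?thesis .
  qed
  then have "char (distr Q borel Z) = char (distr M borel Z)" by auto
  then have eq: "distr Q borel Z = distr M borel Z"
    by (intro Levy_uniqueness) (auto simp: real_distribution_def real_distribution_axioms_def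
        intro!: Q.prob_space_distr prob_space_distr)
  have "expectation (\<lambda>\<omega>. indicator B (Z \<omega>)) = (\<integral>x. indicator B x \<partial>distr M borel Z :: real)"
    by (subst integral_distr) auto
  also have "\<dots> = (\<integral>\<omega>. indicator B (Z \<omega>) \<partial>Q)"
    unfolding eq[symmetric] by (subst integral_distr) auto
  also have "\<dots> = expectation (\<lambda>\<omega>. f \<omega> *\<^sub>R indicator B (Z \<omega>))"
    unfolding Q_def by (intro integral_density) (auto simp: f0)
  also have "\<dots> = expectation (\<lambda>\<omega>. indicator B (Z \<omega>) + (W \<omega> * indicator B (Z \<omega>)) / b)"
    by (intro Bochner_Integration.integral_cong) (auto simp: f_def algebra_simps)
  also have "\<dots> = expectation (\<lambda>\<omega>. indicator B (Z \<omega>)) + expectation (\<lambda>\<omega>. W \<omega> * indicator B (Z \<omega>)) / b"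
  proof (subst Bochner_Integration.integral_add)
    show "integrable M (\<lambda>\<omega>. indicator B (Z \<omega>) :: real)"
      by (rule integrable_const_bound[of _ 1]) auto
    show "integrable M (\<lambda>\<omega>. W \<omega> * indicator B (Z \<omega>) / b)"
      by (rule integrable_const_bound[of _ 1]) (use Wb b in \<open>auto simp: indicator_def\<close>)
  qed auto
  finally show ?thesis using b by simp
qed

text \<open>The frequencies range over a set symmetric about 0, so conjugation shows that
  \<open>cnj W\<close> is orthogonal to the same exponentials. Hence so are the real and imaginary
  parts of \<open>W\<close>, and the real version applies to each.\<close>

lemma (in prob_space) iexp_orthogonal:
  fixes W :: "'a \<Rightarrow> complex" and Z :: "'a \<Rightarrow> real"
  assumes [measurable]: "W \<in> borel_measurable M" "Z \<in> borel_measurable M" "B \<in> sets borel"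
    and bdd: "\<And>\<omega>. norm (W \<omega>) \<le> c"
    and orth: "\<And>u. expectation (\<lambda>\<omega>. W \<omega> * iexp (u * Z \<omega>)) = 0"
  shows "expectation (\<lambda>\<omega>. W \<omega> * complex_of_real (indicator B (Z \<omega>))) = 0"
proof -
  have int: "integrable M (\<lambda>\<omega>. W \<omega> * iexp (u * Z \<omega>))" for u
    by (rule integrable_const_bound[of _ c]) (use bdd in \<open>auto simp: norm_mult\<close>)
  have cnj_eq: "expectation (\<lambda>\<omega>. cnj (W \<omega>) * iexp (u * Z \<omega>)) = 0" for u
  proof -
    have "expectation (\<lambda>\<omega>. cnj (W \<omega>) * iexp (u * Z \<omega>))
        = expectation (\<lambda>\<omega>. cnj (W \<omega> * iexp ((- u) * Z \<omega>)))"
      by (intro Bochner_Integration.integral_cong) (auto simp: exp_cnj)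
    also have "\<dots> = cnj (expectation (\<lambda>\<omega>. W \<omega> * iexp ((- u) * Z \<omega>)))"
      by (rule Bochner_Integration.integral_cnj)
    finally show ?thesis using orth[of "- u"] by simp
  qed
  have int': "integrable M (\<lambda>\<omega>. cnj (W \<omega>) * iexp (u * Z \<omega>))" for u
    using integrable_cnj[OF int[of "- u"]] by (simp add: exp_cnj)
  have 1: "expectation (\<lambda>\<omega>. Re (W \<omega>) * indicator B (Z \<omega>)) = 0"
  proof (rule iexp_orthogonal_real[where c = c])
    fix u
    have "expectation (\<lambda>\<omega>. complex_of_real (Re (W \<omega>)) * iexp (u * Z \<omega>))
        = expectation (\<lambda>\<omega>. (W \<omega> * iexp (u * Z \<omega>) + cnj (W \<omega>) * iexp (u * Z \<omega>)) / 2)"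
      by (intro Bochner_Integration.integral_cong)
        (simp_all only: complex_add_cnj distrib_right[symmetric], simp)
    also have "\<dots> = 0"
      by (simp add: int int' orth cnj_eq del: of_real_mult)
    finally show "expectation (\<lambda>\<omega>. complex_of_real (Re (W \<omega>)) * iexp (u * Z \<omega>)) = 0" .
    show "\<bar>Re (W \<omega>)\<bar> \<le> c" for \<omega>
      by (rule order_trans[OF abs_Re_le_cmod bdd])
  qed measurable
  have 2: "expectation (\<lambda>\<omega>. Im (W \<omega>) * indicator B (Z \<omega>)) = 0"
  proof (rule iexp_orthogonal_real[where c = c])
    fix u
    have im: "complex_of_real (Im z) = (z - cnj z) / (2 * \<i>)" for z
      by (simp add: complex_eq_iff)
    have "expectation (\<lambda>\<omega>. complex_of_real (Im (W \<omega>)) * iexp (u * Z \<omega>))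
        = expectation (\<lambda>\<omega>. (W \<omega> * iexp (u * Z \<omega>) - cnj (W \<omega>) * iexp (u * Z \<omega>)) / (2 * \<i>))"
      by (intro Bochner_Integration.integral_cong)
        (simp_all only: im left_diff_distrib times_divide_eq_left)
    also have "\<dots> = 0"
      by (simp add: int int' orth cnj_eq del: of_real_mult)
    finally show "expectation (\<lambda>\<omega>. complex_of_real (Im (W \<omega>)) * iexp (u * Z \<omega>)) = 0" .
    show "\<bar>Im (W \<omega>)\<bar> \<le> c" for \<omega>
      by (rule order_trans[OF abs_Im_le_cmod bdd])
  qed measurable
  have intB: "integrable M (\<lambda>\<omega>. W \<omega> * complex_of_real (indicator B (Z \<omega>)))"
    by (rule integrable_const_bound[of _ c])
      (use bdd order_trans[OF norm_ge_zero bdd] in \<open>auto simp: norm_mult indicator_def\<close>)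
  show ?thesis
  proof (rule complex_eqI)
    have "Re (expectation (\<lambda>\<omega>. W \<omega> * complex_of_real (indicator B (Z \<omega>)))) = expectation (\<lambda>\<omega>. Re (W \<omega> * complex_of_real (indicator B (Z \<omega>))))"
      by (rule Bochner_Integration.integral_Re[OF intB, symmetric])
    also have "\<dots> = expectation (\<lambda>\<omega>. Re (W \<omega>) * indicator B (Z \<omega>))"
      by (intro Bochner_Integration.integral_cong) (auto simp: indicator_def)
    finally show "Re (expectation (\<lambda>\<omega>. W \<omega> * complex_of_real (indicator B (Z \<omega>)))) = Re 0" using 1 by simp
    have "Im (expectation (\<lambda>\<omega>. W \<omega> * complex_of_real (indicator B (Z \<omega>)))) = expectation (\<lambda>\<omega>. Im (W \<omega> * complex_of_real (indicator B (Z \<omega>))))"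
      by (rule Bochner_Integration.integral_Im[OF intB, symmetric])
    also have "\<dots> = expectation (\<lambda>\<omega>. Im (W \<omega>) * indicator B (Z \<omega>))"
      by (intro Bochner_Integration.integral_cong) (auto simp: indicator_def)
    finally show "Im (expectation (\<lambda>\<omega>. W \<omega> * complex_of_real (indicator B (Z \<omega>)))) = Im 0" using 2 by simp
  qed
qed

text \<open>Kac's theorem. Levy uniqueness is only available on the line, so the exponentials are
  traded for indicators one coordinate at a time.\<close>

lemma (in prob_space) indep_if_char_factors:
  fixes R :: "'a \<Rightarrow> real" and V :: "'i \<Rightarrow> 'a \<Rightarrow> real"
  assumes fin: "finite G"
    and R[measurable]: "R \<in> borel_measurable M"
    and V[measurable]: "\<And>p. p \<in> G \<Longrightarrow> V p \<in> borel_measurable M"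
    and char: "\<And>s u. expectation (\<lambda>\<omega>. iexp (s * R \<omega> + (\<Sum>p\<in>G. u p * V p \<omega>)))
      = expectation (\<lambda>\<omega>. iexp (s * R \<omega>)) * expectation (\<lambda>\<omega>. iexp (\<Sum>p\<in>G. u p * V p \<omega>))"
  shows "distr M (borel \<Otimes>\<^sub>M PiM G (\<lambda>_. borel)) (\<lambda>\<omega>. (R \<omega>, \<lambda>p\<in>G. V p \<omega>))
    = distr M borel R \<Otimes>\<^sub>M distr M (PiM G (\<lambda>_. borel)) (\<lambda>\<omega>. \<lambda>p\<in>G. V p \<omega>)"
proof -
  let ?L = "\<lambda>u \<omega>. \<Sum>p\<in>G. u p * V p \<omega>"
  let ?V = "\<lambda>\<omega>. \<lambda>p\<in>G. V p \<omega>"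
  have Vm[measurable]: "?V \<in> measurable M (PiM G (\<lambda>_. borel))"
    by (intro measurable_restrict V)
  have L[measurable]: "?L u \<in> borel_measurable M" for u by measurable
  have rect: "prob {\<omega>\<in>space M. R \<omega> \<in> B \<and> (\<forall>p\<in>G. V p \<omega> \<in> C p)}
      = prob {\<omega>\<in>space M. R \<omega> \<in> B} * prob {\<omega>\<in>space M. \<forall>p\<in>G. V p \<omega> \<in> C p}"
    if B[measurable]: "B \<in> sets borel" and C[measurable]: "\<And>p. p \<in> G \<Longrightarrow> C p \<in> sets borel" for B C
  proof -
    \<comment> \<open>The set \<open>H\<close> collects the coordinates already traded for
      indicators. The first factor is centred, so once \<open>H = G\<close> and all frequencies are
      0, a vanishing expectation is exactly the product rule.\<close>
    let ?W = "\<lambda>H \<omega>. (indicator B (R \<omega>) - prob {\<omega>\<in>space M. R \<omega> \<in> B})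
        * (\<Prod>p\<in>H. indicator (C p) (V p \<omega>)) :: real"
    have Wm: "?W H \<in> borel_measurable M" if "H \<subseteq> G" for H
    proof -
      have "\<And>p. p \<in> H \<Longrightarrow> V p \<in> borel_measurable M" "\<And>p. p \<in> H \<Longrightarrow> C p \<in> sets borel"
        using that V C by auto
      note [measurable] = this
      show ?thesis by measurable
    qed
    have Wb: "\<bar>?W H \<omega>\<bar> \<le> 1" for H \<omega>
    proof -
      have "\<bar>indicator B (R \<omega>) - prob {\<omega>\<in>space M. R \<omega> \<in> B}\<bar> \<le> 1"
        using prob_le_1[of "{\<omega>\<in>space M. R \<omega> \<in> B}"] measure_nonneg[of M "{\<omega>\<in>space M. R \<omega> \<in> B}"]
        by (simp add: indicator_def)
      moreover have "\<bar>\<Prod>p\<in>H. indicator (C p) (V p \<omega>) :: real\<bar> \<le> 1"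
        unfolding abs_prod by (intro prod_le_1) (auto simp: indicator_def)
      ultimately show ?thesis unfolding abs_mult by (intro mult_le_one) auto
    qed
    \<comment> \<open>The frequencies \<open>u\<close> stay arbitrary in the induction, because the
      step from \<open>H\<close> to \<open>insert k H\<close> changes the frequency at
      \<open>k\<close>.\<close>
    have key: "expectation (\<lambda>\<omega>. complex_of_real (?W H \<omega>) * iexp (?L u \<omega>)) = 0" if "finite H" "H \<subseteq> G" for H u
      using that
    proof (induction H arbitrary: u)
      case empty
      define e where "e = expectation (\<lambda>\<omega>. iexp (?L u \<omega>))"
      have ne: "norm e \<le> 1"
      proof -
        have "norm e \<le> expectation (\<lambda>\<omega>. norm (iexp (?L u \<omega>)))"
          unfolding e_def by (rule integral_norm_bound)
        then show ?thesis by (simp add: prob_space)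
      qed
      have ie: "integrable M (\<lambda>\<omega>. iexp (X \<omega>))" if [measurable]: "X \<in> borel_measurable M" for X
        by (rule integrable_const_bound[of _ 1]) auto
      have iB: "integrable M (\<lambda>\<omega>. complex_of_real (indicator B (R \<omega>)))"
        by (rule integrable_const_bound[of _ 1]) (auto simp: indicator_def)
      have ieB: "integrable M (\<lambda>\<omega>. iexp (?L u \<omega>) * complex_of_real (indicator B (R \<omega>)))"
        by (rule integrable_const_bound[of _ 1]) (auto simp: norm_mult indicator_def)
      \<comment> \<open>Here the exponential in \<open>R\<close> is traded for the indicator of
        \<open>B\<close>: the assumed factorisation says that \<open>iexp (?L u \<omega>)\<close>,
        centred by its mean \<open>e\<close>, is orthogonal to every
        \<open>iexp (s * R \<omega>)\<close>.\<close>
      have "expectation (\<lambda>\<omega>. (iexp (?L u \<omega>) - e) * complex_of_real (indicator B (R \<omega>))) = 0"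
      proof (rule iexp_orthogonal[where c = 2])
        fix \<omega>
        show "norm (iexp (?L u \<omega>) - e) \<le> 2"
          using norm_triangle_ineq4[of "iexp (?L u \<omega>)" e] ne by (simp del: of_real_sum)
      next
        fix s
        have "expectation (\<lambda>\<omega>. (iexp (?L u \<omega>) - e) * iexp (s * R \<omega>))
          = expectation (\<lambda>\<omega>. iexp (s * R \<omega> + ?L u \<omega>) - e * iexp (s * R \<omega>))"
          by (intro Bochner_Integration.integral_cong)
            (auto simp: exp_add algebra_simps simp del: of_real_sum)
        also have "\<dots> = expectation (\<lambda>\<omega>. iexp (s * R \<omega> + ?L u \<omega>)) - expectation (\<lambda>\<omega>. e * iexp (s * R \<omega>))"
          by (intro Bochner_Integration.integral_diff integrable_mult_right ie) measurable
        also have "\<dots> = 0"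
          unfolding char by (simp add: e_def del: of_real_sum)
        finally show "expectation (\<lambda>\<omega>. (iexp (?L u \<omega>) - e) * iexp (s * R \<omega>)) = 0" .
      qed measurable
      also have "expectation (\<lambda>\<omega>. (iexp (?L u \<omega>) - e) * complex_of_real (indicator B (R \<omega>)))
          = expectation (\<lambda>\<omega>. iexp (?L u \<omega>) * complex_of_real (indicator B (R \<omega>))) - e * expectation (\<lambda>\<omega>. complex_of_real (indicator B (R \<omega>)))"
        using iB ieB by (simp add: left_diff_distrib del: of_real_sum)
      finally have 1: "expectation (\<lambda>\<omega>. iexp (?L u \<omega>) * complex_of_real (indicator B (R \<omega>))) = e * expectation (\<lambda>\<omega>. complex_of_real (indicator B (R \<omega>)))"
        by simp
      have "expectation (\<lambda>\<omega>. complex_of_real (indicator B (R \<omega>)))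
          = expectation (\<lambda>\<omega>. complex_of_real (indicator {\<omega>\<in>space M. R \<omega> \<in> B} \<omega>))"
        by (intro Bochner_Integration.integral_cong) (auto simp: indicator_def)
      also have "\<dots> = prob {\<omega>\<in>space M. R \<omega> \<in> B}" by simp
      finally have 2: "expectation (\<lambda>\<omega>. complex_of_real (indicator B (R \<omega>))) = prob {\<omega>\<in>space M. R \<omega> \<in> B}" .
      have "expectation (\<lambda>\<omega>. complex_of_real (?W {} \<omega>) * iexp (?L u \<omega>))
          = expectation (\<lambda>\<omega>. iexp (?L u \<omega>) * complex_of_real (indicator B (R \<omega>)) - prob {\<omega>\<in>space M. R \<omega> \<in> B} * iexp (?L u \<omega>))"
        by (intro Bochner_Integration.integral_cong) (auto simp: algebra_simps simp del: of_real_sum)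
      also have "\<dots> = e * prob {\<omega>\<in>space M. R \<omega> \<in> B} - prob {\<omega>\<in>space M. R \<omega> \<in> B} * e"
        using ieB ie[OF L] 1 2 by (simp add: e_def del: of_real_sum)
      finally show ?case by simp
    next
      case (insert k H)
      have kG: "k \<in> G" and HG: "H \<subseteq> G" using insert.prems by auto
      note [measurable] = Wm[OF HG] V[OF kG] C[OF kG]
      \<comment> \<open>Everything built so far serves as the weight, and the coordinate
        \<open>V k\<close> as the real variable whose exponentials give way to an indicator.\<close>
      have "expectation (\<lambda>\<omega>. (complex_of_real (?W H \<omega>) * iexp (?L u \<omega>)) * complex_of_real (indicator (C k) (V k \<omega>))) = 0"
      proof (rule iexp_orthogonal[where c = 1])
        fix \<omega> show "norm (complex_of_real (?W H \<omega>) * iexp (?L u \<omega>)) \<le> 1"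
          using Wb[of \<omega> H] by (simp only: norm_mult norm_of_real norm_exp_i_times mult_1_right)
      next
        fix t
        \<comment> \<open>The test exponential in \<open>V k\<close> is absorbed by raising the
          frequency at \<open>k\<close> by \<open>t\<close>, so the induction hypothesis covers
          it.\<close>
        have shift: "t * V k \<omega> + ?L u \<omega> = ?L (u(k := u k + t)) \<omega>" for \<omega>
        proof -
          have "?L (u(k := u k + t)) \<omega> = (\<Sum>p\<in>G. u p * V p \<omega> + (if p = k then t * V k \<omega> else 0))"
            by (intro sum.cong) (auto simp: algebra_simps)
          then show ?thesis using fin kG by (simp add: sum.distrib)
        qed
        have "iexp (?L u \<omega>) * iexp (t * V k \<omega>) = iexp (?L (u(k := u k + t)) \<omega>)" for \<omega>
          unfolding shift[symmetric] of_real_add distrib_left exp_add by (rule mult.commute)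
        then have "expectation (\<lambda>\<omega>. (complex_of_real (?W H \<omega>) * iexp (?L u \<omega>)) * iexp (t * V k \<omega>))
            = expectation (\<lambda>\<omega>. complex_of_real (?W H \<omega>) * iexp (?L (u(k := u k + t)) \<omega>))"
          by (simp only: mult.assoc)
        also have "\<dots> = 0" by (rule insert.IH[OF HG])
        finally show "expectation (\<lambda>\<omega>. (complex_of_real (?W H \<omega>) * iexp (?L u \<omega>)) * iexp (t * V k \<omega>)) = 0" .
      qed measurable
      then show ?case using insert.hyps by (simp add: mult_ac del: of_real_sum)
    qed
    let ?A = "{\<omega>\<in>space M. R \<omega> \<in> B}" and ?D = "{\<omega>\<in>space M. \<forall>p\<in>G. V p \<omega> \<in> C p}"
    have [measurable]: "?A \<in> events" "?D \<in> events"
      using fin by measurable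
    have ind: "(\<Prod>p\<in>G. indicator (C p) (V p \<omega>)) = (indicator ?D \<omega> :: real)" if "\<omega> \<in> space M" for \<omega>
      using that fin by (auto simp: indicator_def prod_zero_iff)
    have "0 = expectation (\<lambda>\<omega>. complex_of_real (?W G \<omega>) * iexp (?L (\<lambda>_. 0) \<omega>))"
      by (rule key[OF fin order_refl, symmetric])
    also have "\<dots> = expectation (\<lambda>\<omega>. complex_of_real (indicator (?A \<inter> ?D) \<omega> - prob ?A * indicator ?D \<omega>))"
    proof (intro Bochner_Integration.integral_cong refl)
      fix \<omega> assume w: "\<omega> \<in> space M"
      show "complex_of_real (?W G \<omega>) * iexp (?L (\<lambda>_. 0) \<omega>) = complex_of_real (indicator (?A \<inter> ?D) \<omega> - prob ?A * indicator ?D \<omega>)"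
        unfolding ind[OF w] using w by (simp add: indicator_def)
    qed
    also have "\<dots> = complex_of_real (prob (?A \<inter> ?D) - prob ?A * prob ?D)"
      unfolding integral_complex_of_real by (simp add: emeasure_eq_measure)
    finally have "complex_of_real (prob (?A \<inter> ?D) - prob ?A * prob ?D) = 0" by (rule sym)
    then have "prob (?A \<inter> ?D) = prob ?A * prob ?D"
      unfolding of_real_eq_0_iff by (rule eq_iff_diff_eq_0[THEN iffD2])
    moreover have "?A \<inter> ?D = {\<omega>\<in>space M. R \<omega> \<in> B \<and> (\<forall>p\<in>G. V p \<omega> \<in> C p)}" by auto
    ultimately show ?thesis by (simp only:)
  qed
  let ?P = "PiM G (\<lambda>_. borel :: real measure)"
  let ?EA = "{R -` B \<inter> space M | B. B \<in> sets borel}"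
  let ?EB = "{?V -` E \<inter> space M | E. E \<in> prod_algebra G (\<lambda>_. borel)}"
  \<comment> \<open>The product rule on boxes gives independence of two intersection-stable
    generators; it then extends to the generated sigma-algebras.\<close>
  have "indep_set ?EA ?EB"
    unfolding indep_sets2_eq
  proof (intro conjI ballI)
    show "?EA \<subseteq> events" "?EB \<subseteq> events"
      using sets_PiM[of G "\<lambda>_. borel :: real measure"] by (auto intro!: measurable_sets[OF Vm])
    fix a b assume "a \<in> ?EA" "b \<in> ?EB"
    then obtain B E where a: "a = R -` B \<inter> space M" and B: "B \<in> sets borel"
      and b: "b = ?V -` E \<inter> space M" and E: "E \<in> prod_algebra G (\<lambda>_. borel :: real measure)" by auto
    from E obtain C where C: "E = Pi\<^sub>E G C" "\<And>p. p \<in> G \<Longrightarrow> C p \<in> sets borel"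
      by (elim prod_algebraE_all) (auto simp: Pi_iff)
    have "a = {\<omega>\<in>space M. R \<omega> \<in> B}" "b = {\<omega>\<in>space M. \<forall>p\<in>G. V p \<omega> \<in> C p}"
      "a \<inter> b = {\<omega>\<in>space M. R \<omega> \<in> B \<and> (\<forall>p\<in>G. V p \<omega> \<in> C p)}"
      unfolding a b C by (auto simp: PiE_iff)
    then show "prob (a \<inter> b) = prob a * prob b" using rect[OF B C(2)] by simp
  qed
  moreover have "Int_stable ?EA"
  proof (rule Int_stableI)
    fix a b assume "a \<in> ?EA" "b \<in> ?EA"
    then obtain A B where "a = R -` A \<inter> space M" "A \<in> sets borel" "b = R -` B \<inter> space M" "B \<in> sets borel"
      by auto
    then show "a \<inter> b \<in> ?EA" by (auto intro!: exI[of _ "A \<inter> B"])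
  qed
  moreover have "Int_stable ?EB"
  proof (rule Int_stableI)
    fix a b assume "a \<in> ?EB" "b \<in> ?EB"
    then obtain A B where "a = ?V -` A \<inter> space M" "A \<in> prod_algebra G (\<lambda>_. borel)"
      "b = ?V -` B \<inter> space M" "B \<in> prod_algebra G (\<lambda>_. borel)"
      by auto
    then show "a \<inter> b \<in> ?EB"
      using Int_stable_prod_algebra[of G "\<lambda>_. borel :: real measure"]
      by (auto intro!: exI[of _ "A \<inter> B"] simp: Int_stable_def)
  qed
  ultimately have ind: "indep_set (sigma_sets (space M) ?EA) (sigma_sets (space M) ?EB)"
    by (rule indep_set_sigma_sets)
  have prodAB: "prob (R -` A \<inter> space M \<inter> (?V -` B \<inter> space M)) = prob (R -` A \<inter> space M) * prob (?V -` B \<inter> space M)"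
    if A: "A \<in> sets borel" and B: "B \<in> sets ?P" for A B
  proof (rule indep_setD[OF ind])
    show "R -` A \<inter> space M \<in> sigma_sets (space M) ?EA" using A by (auto intro: sigma_sets.Basic)
    \<comment> \<open>Preimages under \<open>?V\<close> commute with generating a sigma-algebra, so
      each measurable set of the product space pulls back into the sigma-algebra generated by
      \<open>?EB\<close>.\<close>
    have "?V \<in> space M \<rightarrow> (\<Pi>\<^sub>E i\<in>G. space (borel :: real measure))" by auto
    from sigma_sets_vimage_commute[OF this, of "prod_algebra G (\<lambda>_. borel)"]
    show "?V -` B \<inter> space M \<in> sigma_sets (space M) ?EB"
      using B unfolding sets_PiM by blast
  qed
  interpret DR: prob_space "distr M borel R" by (rule prob_space_distr) measurable
  interpret DV: prob_space "distr M ?P ?V" by (rule prob_space_distr) measurable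
  show ?thesis
  proof (rule pair_measure_eqI[symmetric])
    show "sigma_finite_measure (distr M borel R)" "sigma_finite_measure (distr M ?P ?V)" ..
    fix A B assume "A \<in> sets (distr M borel R)" "B \<in> sets (distr M ?P ?V)"
    then have AB[measurable]: "A \<in> sets borel" "B \<in> sets ?P" by auto
    have eq: "(\<lambda>\<omega>. (R \<omega>, ?V \<omega>)) -` (A \<times> B) \<inter> space M = R -` A \<inter> space M \<inter> (?V -` B \<inter> space M)" by auto
    have "emeasure (distr M (borel \<Otimes>\<^sub>M ?P) (\<lambda>\<omega>. (R \<omega>, ?V \<omega>))) (A \<times> B)
        = emeasure M (R -` A \<inter> space M \<inter> (?V -` B \<inter> space M))"
      by (subst emeasure_distr) (measurable, simp only: eq)
    also have "\<dots> = emeasure M (R -` A \<inter> space M) * emeasure M (?V -` B \<inter> space M)"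
      unfolding emeasure_eq_measure prodAB[OF AB] by (intro ennreal_mult) auto
    also have "\<dots> = emeasure (distr M borel R) A * emeasure (distr M ?P ?V) B"
      unfolding emeasure_distr[OF R AB(1)] emeasure_distr[OF Vm AB(2)] by (rule refl)
    finally show "emeasure (distr M borel R) A * emeasure (distr M ?P ?V) B
        = emeasure (distr M (borel \<Otimes>\<^sub>M ?P) (\<lambda>\<omega>. (R \<omega>, ?V \<omega>))) (A \<times> B)" by (rule sym)
  qed (simp only: sets_distr, intro sets_pair_measure_cong sets_distr)
qed

subsection \<open>Gaussian small ball estimates\<close>

text \<open>Both intervals have the same length, hence so do their two set differences. The density
  is at most its value at \<open>h\<close> outside the centred interval and at least that value
  inside, so exchanging one difference for the other cannot lose mass.\<close>

lemma std_normal_interval_le: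
  assumes h: "0 \<le> h"
  shows "emeasure std_normal_distribution {c - h..c + h} \<le> emeasure std_normal_distribution {- h..h}"
proof -
  let ?A = "{c - h..c + h}" and ?B = "{- h..h}" and ?f = std_normal_density
  have out: "?f x \<le> ?f h" if "x \<notin> ?B" for x
  proof -
    have "h\<^sup>2 \<le> x\<^sup>2" using that h by (intro abs_le_square_iff[THEN iffD1]) auto
    then show ?thesis unfolding std_normal_density_def by (intro mult_left_mono) auto
  qed
  have inn: "?f h \<le> ?f x" if "x \<in> ?B" for x
  proof -
    have "x\<^sup>2 \<le> h\<^sup>2" using that h by (intro abs_le_square_iff[THEN iffD1]) auto
    then show ?thesis unfolding std_normal_density_def by (intro mult_left_mono) auto
  qed
  have fin: "emeasure lborel (?A \<inter> ?B) \<noteq> \<infinity>"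
    by (simp add: Int_atLeastAtMost emeasure_lborel_Icc_eq)
  have len: "emeasure lborel (?A - ?B) = emeasure lborel (?B - ?A)"
  proof -
    have "emeasure lborel (?A - ?B) = emeasure lborel (?A - ?A \<inter> ?B)"
      by (intro arg_cong[where f = "emeasure lborel"]) auto
    also have "\<dots> = emeasure lborel ?A - emeasure lborel (?A \<inter> ?B)"
      by (intro emeasure_Diff fin) auto
    also have "emeasure lborel ?A = emeasure lborel ?B" using h by simp
    also have "emeasure lborel ?B - emeasure lborel (?A \<inter> ?B) = emeasure lborel (?B - ?A \<inter> ?B)"
      by (intro emeasure_Diff[symmetric] fin) auto
    also have "\<dots> = emeasure lborel (?B - ?A)"
      by (intro arg_cong[where f = "emeasure lborel"]) auto
    finally show ?thesis .
  qed
  have "emeasure std_normal_distribution (?A - ?B) = (\<integral>\<^sup>+x. ennreal (?f x) * indicator (?A - ?B) x \<partial>lborel)"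
    by (intro emeasure_density) auto
  also have "\<dots> \<le> (\<integral>\<^sup>+x. ennreal (?f h) * indicator (?A - ?B) x \<partial>lborel)"
    using out by (intro nn_integral_mono) (auto simp: indicator_def intro!: ennreal_leI)
  also have "\<dots> = ?f h * emeasure lborel (?A - ?B)"
    by (intro nn_integral_cmult_indicator) auto
  also have "\<dots> = (\<integral>\<^sup>+x. ennreal (?f h) * indicator (?B - ?A) x \<partial>lborel)" 
    unfolding len by (intro nn_integral_cmult_indicator[symmetric]) auto
  also have "\<dots> \<le> (\<integral>\<^sup>+x. ennreal (?f x) * indicator (?B - ?A) x \<partial>lborel)"
    using inn by (intro nn_integral_mono) (auto simp: indicator_def intro!: ennreal_leI)
  also have "\<dots> = emeasure std_normal_distribution (?B - ?A)"
    by (intro emeasure_density[symmetric]) auto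
  finally have le: "emeasure std_normal_distribution (?A - ?B) \<le> emeasure std_normal_distribution (?B - ?A)" .
  have "emeasure std_normal_distribution ?A
      = emeasure std_normal_distribution (?A - ?B) + emeasure std_normal_distribution (?A \<inter> ?B)"
    by (subst plus_emeasure) (auto intro!: arg_cong[where f = "emeasure std_normal_distribution"])
  also have "\<dots> \<le> emeasure std_normal_distribution (?B - ?A) + emeasure std_normal_distribution (?A \<inter> ?B)"
    by (intro add_right_mono le)
  also have "\<dots> = emeasure std_normal_distribution ?B"
    by (subst plus_emeasure) (auto intro!: arg_cong[where f = "emeasure std_normal_distribution"])
  finally show ?thesis .
qed

text \<open>For nonzero \<open>d\<close> the left set is an interval of half-length
  \<open>\<epsilon> / \<bar>\<sigma> * d\<bar>\<close>. Centring it at 0 does not decrease its mass,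
  and as \<open>\<sigma>\<close> is at least 1 the centred interval lies inside the right
  set.\<close>

lemma std_normal_affine_le:
  assumes \<sigma>: "1 \<le> \<sigma>" and \<epsilon>: "0 \<le> \<epsilon>"
  shows "emeasure std_normal_distribution {r. \<bar>\<sigma> * r * d + y\<bar> \<le> \<epsilon>}
    \<le> emeasure std_normal_distribution {r. \<bar>r\<bar> * \<bar>d\<bar> \<le> \<epsilon>}"
proof (cases "d = 0")
  case True
  \<comment> \<open>With \<open>d = 0\<close> the right set is the whole line, since
    \<open>\<epsilon>\<close> is nonnegative.\<close>
  then show ?thesis using \<epsilon> by (auto intro!: emeasure_mono)
next
  case False
  define k where "k = \<bar>\<sigma> * d\<bar>"
  have k: "0 < k" "\<bar>d\<bar> \<le> k" using \<sigma> False by (auto simp: k_def abs_mult)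
  have "{r. \<bar>\<sigma> * r * d + y\<bar> \<le> \<epsilon>} = {- y / (\<sigma> * d) - \<epsilon> / k..- y / (\<sigma> * d) + \<epsilon> / k}"
  proof (rule Set.set_eqI)
    fix r
    have "\<sigma> * r * d + y = (\<sigma> * d) * (r - (- y / (\<sigma> * d)))"
      using False \<sigma> by (simp add: field_simps)
    then have "\<bar>\<sigma> * r * d + y\<bar> = k * \<bar>r - (- y / (\<sigma> * d))\<bar>" by (simp only: k_def abs_mult)
    then have "\<bar>\<sigma> * r * d + y\<bar> \<le> \<epsilon> \<longleftrightarrow> \<bar>r - (- y / (\<sigma> * d))\<bar> \<le> \<epsilon> / k"
      using k by (simp add: field_simps)
    then show "r \<in> {r. \<bar>\<sigma> * r * d + y\<bar> \<le> \<epsilon>}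
        \<longleftrightarrow> r \<in> {- y / (\<sigma> * d) - \<epsilon> / k..- y / (\<sigma> * d) + \<epsilon> / k}"
      by (auto simp: abs_le_iff)
  qed
  then have "emeasure std_normal_distribution {r. \<bar>\<sigma> * r * d + y\<bar> \<le> \<epsilon>}
      \<le> emeasure std_normal_distribution {- (\<epsilon> / k)..\<epsilon> / k}"
    using \<epsilon> k by (simp only: std_normal_interval_le divide_nonneg_pos)
  also have "\<dots> \<le> emeasure std_normal_distribution {r. \<bar>r\<bar> * \<bar>d\<bar> \<le> \<epsilon>}"
  proof (intro emeasure_mono subsetI CollectI)
    fix r assume "r \<in> {- (\<epsilon> / k)..\<epsilon> / k}"
    then have "\<bar>r\<bar> \<le> \<epsilon> / k" by auto
    then have "\<bar>r\<bar> * k \<le> \<epsilon>" using k by (simp add: field_simps)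
    moreover have "\<bar>r\<bar> * \<bar>d\<bar> \<le> \<bar>r\<bar> * k" using k by (intro mult_left_mono) auto
    ultimately show "\<bar>r\<bar> * \<bar>d\<bar> \<le> \<epsilon>" by linarith
  qed simp
  finally show ?thesis .
qed

text \<open>Independence allows freezing \<open>V\<close> and bounding the probability over
  \<open>R\<close> alone, which removes the shift \<open>y\<close> and replaces
  \<open>\<sigma>\<close> by 1. The bound is written with the normal variable outermost, so that for
  fixed \<open>r\<close> only an event about \<open>d (V \<omega>)\<close> remains, ready for an
  induction hypothesis.\<close>

lemma (in prob_space) normal_affine_small_ball:
  fixes R :: "'a \<Rightarrow> real" and V :: "'a \<Rightarrow> 'b" and d y :: "'b \<Rightarrow> real"
  assumes R: "distributed M lborel R (normal_density 0 \<sigma>)"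
    and V[measurable]: "V \<in> measurable M P"
    and d[measurable]: "d \<in> borel_measurable P" and y[measurable]: "y \<in> borel_measurable P"
    and indep: "distr M (borel \<Otimes>\<^sub>M P) (\<lambda>\<omega>. (R \<omega>, V \<omega>)) = distr M borel R \<Otimes>\<^sub>M distr M P V"
    and \<sigma>: "1 \<le> \<sigma>" and \<epsilon>: "0 \<le> \<epsilon>"
  shows "emeasure M {\<omega>\<in>space M. \<bar>R \<omega> * d (V \<omega>) + y (V \<omega>)\<bar> \<le> \<epsilon>}
    \<le> (\<integral>\<^sup>+r. emeasure M {\<omega>\<in>space M. \<bar>r\<bar> * \<bar>d (V \<omega>)\<bar> \<le> \<epsilon>} \<partial>std_normal_distribution)"
proof -
  have [measurable]: "R \<in> borel_measurable M" using distributed_measurable[OF R] by simp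
  define g where "g \<omega> = R \<omega> / \<sigma>" for \<omega>
  have g: "distributed M lborel g std_normal_density"
    using normal_standard_normal_convert[of \<sigma> R 0] R \<sigma> by (simp add: g_def[abs_def])
  have [measurable]: "g \<in> borel_measurable M" unfolding g_def by measurable
  have Rg: "R \<omega> = \<sigma> * g \<omega>" for \<omega> using \<sigma> by (simp add: g_def)
  have std: "distr M lborel g = std_normal_distribution"
    using distributed_distr_eq_density[OF g] .
  have distrR: "emeasure (distr M borel R) {r. \<bar>r * b + c\<bar> \<le> \<epsilon>}
      = emeasure std_normal_distribution {r. \<bar>\<sigma> * r * b + c\<bar> \<le> \<epsilon>}" for b c
    unfolding std[symmetric]
    by (simp add: emeasure_distr Rg vimage_def)
  interpret DR: prob_space "distr M borel R" by (rule prob_space_distr) measurable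
  interpret DV: prob_space "distr M P V" by (rule prob_space_distr) measurable
  interpret S: real_distribution std_normal_distribution by (rule real_dist_normal_dist)
  interpret RV: pair_sigma_finite "distr M borel R" "distr M P V" ..
  interpret SV: pair_sigma_finite std_normal_distribution "distr M P V" ..
  have [measurable]: "(\<lambda>\<omega>. (R \<omega>, V \<omega>)) \<in> measurable M (borel \<Otimes>\<^sub>M P)" by measurable
  let ?E = "{z\<in>space (borel \<Otimes>\<^sub>M P). \<bar>fst z * d (snd z) + y (snd z)\<bar> \<le> \<epsilon>}"
  let ?F = "{z\<in>space (borel \<Otimes>\<^sub>M P). \<bar>fst z\<bar> * \<bar>d (snd z)\<bar> \<le> \<epsilon>}"
  have E[measurable]: "?E \<in> sets (borel \<Otimes>\<^sub>M P)" by measurable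
  have F[measurable]: "?F \<in> sets (borel \<Otimes>\<^sub>M P)" by measurable
  have E': "?E \<in> sets (distr M borel R \<Otimes>\<^sub>M distr M P V)"
    using E by (simp only: sets_pair_measure_cong[OF sets_distr sets_distr])
  have F': "?F \<in> sets (std_normal_distribution \<Otimes>\<^sub>M distr M P V)"
    using F by (simp only: sets_pair_measure_cong[OF _ sets_distr, of std_normal_distribution borel] sets_density sets_lborel)
  have "emeasure M {\<omega>\<in>space M. \<bar>R \<omega> * d (V \<omega>) + y (V \<omega>)\<bar> \<le> \<epsilon>}
      = emeasure (distr M (borel \<Otimes>\<^sub>M P) (\<lambda>\<omega>. (R \<omega>, V \<omega>))) ?E"
    by (subst emeasure_distr)
      (auto intro!: arg_cong[where f = "emeasure M"] simp: space_pair_measure measurable_space[OF V])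
  \<comment> \<open>First use of Fubini: \<open>v\<close> is outermost, so \<open>d v\<close> and
    \<open>y v\<close> are constants in the inner probability.\<close>
  also have "\<dots> = (\<integral>\<^sup>+v. emeasure (distr M borel R) ((\<lambda>r. (r, v)) -` ?E) \<partial>distr M P V)"
    unfolding indep by (rule RV.emeasure_pair_measure_alt2[OF E'])
  also have "\<dots> \<le> (\<integral>\<^sup>+v. emeasure std_normal_distribution ((\<lambda>r. (r, v)) -` ?F) \<partial>distr M P V)"
  proof (rule nn_integral_mono)
    fix v assume "v \<in> space (distr M P V)"
    then have "(\<lambda>r. (r, v)) -` ?E = {r. \<bar>r * d v + y v\<bar> \<le> \<epsilon>}"
      "(\<lambda>r. (r, v)) -` ?F = {r. \<bar>r\<bar> * \<bar>d v\<bar> \<le> \<epsilon>}"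
      by (auto simp: space_pair_measure)
    then show "emeasure (distr M borel R) ((\<lambda>r. (r, v)) -` ?E)
        \<le> emeasure std_normal_distribution ((\<lambda>r. (r, v)) -` ?F)"
      using std_normal_affine_le[OF \<sigma> \<epsilon>] by (simp only: distrR)
  qed
  \<comment> \<open>The sections are reassembled into a product measure in order to integrate in the
    other order.\<close>
  also have "\<dots> = emeasure (std_normal_distribution \<Otimes>\<^sub>M distr M P V) ?F"
    by (rule SV.emeasure_pair_measure_alt2[OF F', symmetric])
  also have "\<dots> = (\<integral>\<^sup>+r. emeasure (distr M P V) (Pair r -` ?F) \<partial>std_normal_distribution)"
    by (rule DV.emeasure_pair_measure_alt[OF F'])
  also have "\<dots> = (\<integral>\<^sup>+r. emeasure M {\<omega>\<in>space M. \<bar>r\<bar> * \<bar>d (V \<omega>)\<bar> \<le> \<epsilon>} \<partial>std_normal_distribution)"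
  proof (intro nn_integral_cong)
    fix r
    have eq: "Pair r -` ?F = {v\<in>space P. \<bar>r\<bar> * \<bar>d v\<bar> \<le> \<epsilon>}" by (auto simp: space_pair_measure)
    have "V -` {v\<in>space P. \<bar>r\<bar> * \<bar>d v\<bar> \<le> \<epsilon>} \<inter> space M = {\<omega>\<in>space M. \<bar>r\<bar> * \<bar>d (V \<omega>)\<bar> \<le> \<epsilon>}"
      using measurable_space[OF V] by auto
    then show "emeasure (distr M P V) (Pair r -` ?F) = emeasure M {\<omega>\<in>space M. \<bar>r\<bar> * \<bar>d (V \<omega>)\<bar> \<le> \<epsilon>}"
      unfolding eq by (simp add: emeasure_distr)
  qed
  finally show ?thesis .
qed

text \<open>Conditioning on the last factor gives an integral of the same shape as the bound in
  \<open>normal_affine_small_ball\<close>, so the two can be compared integrand by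
  integrand.\<close>

lemma (in prob_space) emeasure_prod_std_normal_Suc:
  fixes X :: "nat \<Rightarrow> 'a \<Rightarrow> real"
  assumes ind: "indep_vars (\<lambda>_. borel) X {1..Suc m}"
    and X: "distributed M lborel (X (Suc m)) std_normal_density"
  shows "emeasure M {\<omega>\<in>space M. (\<Prod>j = 1..Suc m. \<bar>X j \<omega>\<bar>) \<le> \<epsilon>}
    = (\<integral>\<^sup>+r. emeasure M {\<omega>\<in>space M. \<bar>r\<bar> * (\<Prod>j = 1..m. \<bar>X j \<omega>\<bar>) \<le> \<epsilon>} \<partial>std_normal_distribution)"
proof -
  define Z where "Z = X (Suc m)"
  \<comment> \<open>The product is formed without absolute values, since independence is inherited
    by products of the variables themselves; \<open>absY\<close> restores the absolute
    values.\<close>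
  define Y where "Y \<omega> = (\<Prod>j = 1..m. X j \<omega>)" for \<omega>
  have [measurable]: "X j \<in> borel_measurable M" if "j \<in> {1..Suc m}" for j
    using ind that by (auto simp: indep_vars_def)
  have [measurable]: "Z \<in> borel_measurable M" unfolding Z_def by measurable
  have [measurable]: "Y \<in> borel_measurable M" unfolding Y_def by measurable
  have absY: "(\<Prod>j = 1..m. \<bar>X j \<omega>\<bar>) = \<bar>Y \<omega>\<bar>" for \<omega> by (simp add: Y_def abs_prod)
  have "indep_var borel Z borel Y"
    unfolding Z_def Y_def using ind
    by (intro indep_vars_prod) (auto simp: atLeastAtMostSuc_conv)
  then have joint: "distr M borel Z \<Otimes>\<^sub>M distr M borel Y = distr M (borel \<Otimes>\<^sub>M borel) (\<lambda>\<omega>. (Z \<omega>, Y \<omega>))"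
    by (simp add: indep_var_distribution_eq)
  have std: "distr M borel Z = std_normal_distribution"
    using distributed_distr_eq_density[OF X] by (simp add: Z_def cong: distr_cong)
  interpret DY: prob_space "distr M borel Y" by (rule prob_space_distr) measurable
  let ?F = "{z. \<bar>fst z\<bar> * \<bar>snd z\<bar> \<le> \<epsilon>} :: (real \<times> real) set"
  have F: "?F \<in> sets (borel \<Otimes>\<^sub>M borel)" 
  proof -
    have "{z\<in>space (borel \<Otimes>\<^sub>M borel). \<bar>fst z\<bar> * \<bar>snd z\<bar> \<le> \<epsilon>} \<in> sets (borel \<Otimes>\<^sub>M borel :: (real \<times> real) measure)"
      by measurable
    then show ?thesis by (simp add: space_pair_measure)
  qed
  have "emeasure M {\<omega>\<in>space M. (\<Prod>j = 1..Suc m. \<bar>X j \<omega>\<bar>) \<le> \<epsilon>}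
      = emeasure (distr M (borel \<Otimes>\<^sub>M borel) (\<lambda>\<omega>. (Z \<omega>, Y \<omega>))) ?F"
    using F by (subst emeasure_distr)
      (auto intro!: arg_cong[where f = "emeasure M"] simp: absY Z_def mult.commute simp del: One_nat_def)
  also have "\<dots> = emeasure (std_normal_distribution \<Otimes>\<^sub>M distr M borel Y) ?F"
    by (simp only: joint[symmetric] std)
  also have "\<dots> = (\<integral>\<^sup>+r. emeasure (distr M borel Y) (Pair r -` ?F) \<partial>std_normal_distribution)"
    using F by (intro DY.emeasure_pair_measure_alt)
      (simp only: sets_pair_measure_cong[OF _ sets_distr, of std_normal_distribution borel] sets_density sets_lborel)
  also have "\<dots> = (\<integral>\<^sup>+r. emeasure M {\<omega>\<in>space M. \<bar>r\<bar> * (\<Prod>j = 1..m. \<bar>X j \<omega>\<bar>) \<le> \<epsilon>} \<partial>std_normal_distribution)"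
    by (intro nn_integral_cong)
      (auto intro!: arg_cong[where f = "emeasure M"] simp: emeasure_distr absY simp del: One_nat_def)
  finally show ?thesis .
qed

subsection \<open>Orthogonal projection\<close>

text \<open>Measurability is a separate conjunct because integrability of the square does not imply
  it.\<close>

definition square_integrable :: "'a measure \<Rightarrow> ('a \<Rightarrow> real) \<Rightarrow> bool" where
  "square_integrable M X \<longleftrightarrow> X \<in> borel_measurable M \<and> integrable M (\<lambda>\<omega>. (X \<omega>)\<^sup>2)"

lemma square_integrable_mult:
  assumes "square_integrable M X" "square_integrable M Y"
  shows "integrable M (\<lambda>\<omega>. X \<omega> * Y \<omega>)"
proof (rule Bochner_Integration.integrable_bound)
  show "integrable M (\<lambda>\<omega>. (X \<omega>)\<^sup>2 + (Y \<omega>)\<^sup>2)" "(\<lambda>\<omega>. X \<omega> * Y \<omega>) \<in> borel_measurable M"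
    using assms by (auto simp: square_integrable_def)
  show "AE \<omega> in M. norm (X \<omega> * Y \<omega>) \<le> norm ((X \<omega>)\<^sup>2 + (Y \<omega>)\<^sup>2)"
  proof (intro AE_I2)
    fix \<omega>
    have "2 * (\<bar>X \<omega>\<bar> * \<bar>Y \<omega>\<bar>) \<le> (X \<omega>)\<^sup>2 + (Y \<omega>)\<^sup>2"
      using sum_squares_bound[of "\<bar>X \<omega>\<bar>" "\<bar>Y \<omega>\<bar>"] by (simp add: mult.assoc)
    moreover have "0 \<le> \<bar>X \<omega>\<bar> * \<bar>Y \<omega>\<bar>" by simp
    ultimately have "\<bar>X \<omega>\<bar> * \<bar>Y \<omega>\<bar> \<le> (X \<omega>)\<^sup>2 + (Y \<omega>)\<^sup>2" by linarith
    then show "norm (X \<omega> * Y \<omega>) \<le> norm ((X \<omega>)\<^sup>2 + (Y \<omega>)\<^sup>2)"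
      by (simp add: abs_mult)
  qed
qed

lemma square_integrable_cmult:
  "square_integrable M X \<Longrightarrow> square_integrable M (\<lambda>\<omega>. c * X \<omega>)"
  by (auto simp: square_integrable_def power_mult_distrib)

lemma square_integrable_add:
  assumes "square_integrable M X" "square_integrable M Y"
  shows "square_integrable M (\<lambda>\<omega>. X \<omega> + Y \<omega>)"
  using assms square_integrable_mult[OF assms]
  by (auto simp: square_integrable_def power2_sum mult.assoc)

lemma square_integrable_diff:
  assumes "square_integrable M X" "square_integrable M Y"
  shows "square_integrable M (\<lambda>\<omega>. X \<omega> - Y \<omega>)"
  using square_integrable_add[OF assms(1) square_integrable_cmult[OF assms(2), of "- 1"]] by simp

lemma square_integrable_sum:
  assumes "\<And>p. p \<in> G \<Longrightarrow> square_integrable M (v p)"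
  shows "square_integrable M (\<lambda>\<omega>. \<Sum>p\<in>G. c p * v p \<omega>)"
  using assms
proof (induction G rule: infinite_finite_induct)
  case (insert g G)
  then show ?case
    by (simp add: square_integrable_add square_integrable_cmult)
qed (simp_all add: square_integrable_def)

text \<open>One Gram-Schmidt step per element of \<open>G\<close>: both \<open>x\<close> and the new
  vector \<open>v g\<close> are first made orthogonal to the old vectors, then the residual of
  \<open>x\<close> is projected off the residual of \<open>v g\<close>. The family may be linearly
  dependent.\<close>

lemma orthogonal_residual_exists:
  fixes v :: "'i \<Rightarrow> 'a \<Rightarrow> real"
  assumes "finite G" "\<And>p. p \<in> G \<Longrightarrow> square_integrable M (v p)" "square_integrable M x"
  shows "\<exists>a. \<forall>q\<in>G. (\<integral>\<omega>. (x \<omega> - (\<Sum>p\<in>G. a p * v p \<omega>)) * v q \<omega> \<partial>M) = 0"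
  using assms
proof (induction G arbitrary: x)
  case (insert g G)
  let ?I = "\<lambda>X Y. \<integral>\<omega>. X \<omega> * Y \<omega> \<partial>M"
  have sv: "square_integrable M (v p)" if "p \<in> insert g G" for p using insert.prems that by auto
  obtain a where a: "\<And>q. q \<in> G \<Longrightarrow> ?I (\<lambda>\<omega>. x \<omega> - (\<Sum>p\<in>G. a p * v p \<omega>)) (v q) = 0"
    using insert.IH[of x] insert.prems by auto
  obtain b where b: "\<And>q. q \<in> G \<Longrightarrow> ?I (\<lambda>\<omega>. v g \<omega> - (\<Sum>p\<in>G. b p * v p \<omega>)) (v q) = 0"
    using insert.IH[of "v g"] insert.prems by auto
  define x' where "x' \<omega> = x \<omega> - (\<Sum>p\<in>G. a p * v p \<omega>)" for \<omega>
  define g' where "g' \<omega> = v g \<omega> - (\<Sum>p\<in>G. b p * v p \<omega>)" for \<omega>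
  have sx: "square_integrable M x'" and sg: "square_integrable M g'"
    unfolding x'_def g'_def using insert.prems
    by (auto intro!: square_integrable_diff square_integrable_sum)
  \<comment> \<open>If \<open>g'\<close> has norm 0, division by zero sets \<open>t\<close> to 0.
    The equation below still holds, because \<open>g'\<close> then vanishes almost
    everywhere.\<close>
  define t where "t = ?I x' g' / ?I g' g'"
  have t: "?I x' g' = t * ?I g' g'"
  proof (cases "?I g' g' = 0")
    case True
    then have "AE \<omega> in M. g' \<omega> * g' \<omega> = 0"
      using integral_nonneg_eq_0_iff_AE[OF square_integrable_mult[OF sg sg]] by simp
    then have "AE \<omega> in M. x' \<omega> * g' \<omega> = 0" by auto
    then have "?I x' g' = 0"
      by (rule integral_eq_zero_AE)
    then show ?thesis using True by simp
  qed (simp add: t_def)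
  define r where "r \<omega> = x' \<omega> - t * g' \<omega>" for \<omega>
  have sr: "square_integrable M r"
    unfolding r_def by (intro square_integrable_diff square_integrable_cmult sx sg)
  have rdist: "?I r Y = ?I x' Y - t * ?I g' Y" if "square_integrable M Y" for Y
    unfolding r_def using square_integrable_mult[OF sx that] square_integrable_mult[OF sg that]
    by (simp add: left_diff_distrib mult.assoc)
  have rq: "?I r (v q) = 0" if "q \<in> G" for q
    using a[OF that] b[OF that] sv that by (subst rdist) (auto simp: x'_def g'_def)
  \<comment> \<open>The vector \<open>v g\<close> is \<open>g'\<close> plus a combination of old
    vectors, and \<open>r\<close> is orthogonal to both.\<close>
  have "?I r (v g) = (\<integral>\<omega>. r \<omega> * g' \<omega> + (\<Sum>p\<in>G. b p * (r \<omega> * v p \<omega>)) \<partial>M)"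
    by (intro Bochner_Integration.integral_cong)
      (auto simp: g'_def algebra_simps sum_distrib_left)
  also have "\<dots> = ?I r g' + (\<Sum>p\<in>G. b p * ?I r (v p))"
    using square_integrable_mult[OF sr sg] square_integrable_mult[OF sr sv]
    by (subst Bochner_Integration.integral_add) (auto intro!: Bochner_Integration.integral_sum)
  also have "\<dots> = 0" using rq t by (simp add: rdist[OF sg])
  finally have rg: "?I r (v g) = 0" .
  define c where "c p = (if p = g then t else a p - t * b p)" for p
  have "r \<omega> = x \<omega> - (\<Sum>p\<in>insert g G. c p * v p \<omega>)" for \<omega>
  proof -
    have "(\<Sum>p\<in>G. c p * v p \<omega>) = (\<Sum>p\<in>G. a p * v p \<omega> - t * (b p * v p \<omega>))"
      using insert.hyps by (intro sum.cong) (auto simp: c_def algebra_simps)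
    then show ?thesis
      using insert.hyps
      by (simp add: r_def x'_def g'_def c_def sum_subtractf sum_distrib_left algebra_simps)
  qed
  then show ?case using rq rg by (intro exI[of _ c]) auto
qed simp

subsection \<open>Gaussian families\<close>

lemma (in prob_space) centered_gaussian_cases:
  assumes L: "gaussian_rv M L" and E: "expectation L = 0"
  obtains (normal) \<sigma> where "\<sigma> > 0" "distributed M lborel L (normal_density 0 \<sigma>)" "expectation (\<lambda>\<omega>. (L \<omega>)\<^sup>2) = \<sigma>\<^sup>2"
  | (degenerate) "AE \<omega> in M. L \<omega> = 0"
proof -
  have [measurable]: "L \<in> borel_measurable M" using L by (simp add: gaussian_rv_def)
  from L consider \<mu> \<sigma> where "\<sigma> > 0" "distributed M lborel L (normal_density \<mu> \<sigma>)"
    | \<mu> where "AE \<omega> in M. L \<omega> = \<mu>"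
    unfolding gaussian_rv_def by blast
  then show ?thesis
  proof cases
    case 1
    then have "\<mu> = 0" using normal_distributed_expectation E by auto
    with 1 show ?thesis using normal_distributed_variance[OF 1] E by (intro normal) auto
  next
    case 2
    have "expectation L = expectation (\<lambda>_. \<mu>)" by (intro integral_cong_AE) (use 2 in auto)
    then have "\<mu> = 0" using E by (simp add: prob_space)
    with 2 show ?thesis by (intro degenerate) simp
  qed
qed

text \<open>The second moment alone determines the characteristic function, with one formula for the
  degenerate and nondegenerate cases. Factorisation of characteristic functions thereby reduces to
  additivity of variances.\<close>

lemma (in prob_space) centered_gaussian:
  assumes L: "gaussian_rv M L" and E: "expectation L = 0"
  shows square_integrable_centered_gaussian: "integrable M (\<lambda>\<omega>. (L \<omega>)\<^sup>2)"
    and char_centered_gaussian: "expectation (\<lambda>\<omega>. iexp (L \<omega>)) = exp (- expectation (\<lambda>\<omega>. (L \<omega>)\<^sup>2) / 2)"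
proof -
  have [measurable]: "L \<in> borel_measurable M" using L by (simp add: gaussian_rv_def)
  have "integrable M (\<lambda>\<omega>. (L \<omega>)\<^sup>2) \<and>
    expectation (\<lambda>\<omega>. iexp (L \<omega>)) = exp (- expectation (\<lambda>\<omega>. (L \<omega>)\<^sup>2) / 2)"
    using L E
  proof (cases rule: centered_gaussian_cases)
    case (normal \<sigma>)
    have "integrable lborel (\<lambda>x. normal_density 0 \<sigma> x * x\<^sup>2)"
      using integrable_normal_moment[OF normal(1), of 0 2] by simp
    then have int: "integrable M (\<lambda>\<omega>. (L \<omega>)\<^sup>2)"
      by (subst distributed_integrable[OF normal(2), symmetric]) auto
    define g where "g \<omega> = L \<omega> / \<sigma>" for \<omega>
    have g: "distributed M lborel g std_normal_density"
      using normal_standard_normal_convert[of \<sigma> L 0] normal by (simp add: g_def[abs_def])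
    have [measurable]: "g \<in> borel_measurable M" unfolding g_def by measurable
    have "expectation (\<lambda>\<omega>. iexp (L \<omega>)) = expectation (\<lambda>\<omega>. iexp (\<sigma> * g \<omega>))"
      using normal(1) by (simp add: g_def)
    also have "\<dots> = char (distr M lborel g) \<sigma>"
      by (simp add: char_def integral_distr)
    also have "\<dots> = exp (- \<sigma>\<^sup>2 / 2)"
      unfolding distributed_distr_eq_density[OF g] by (simp add: char_std_normal_distribution)
    finally show ?thesis using int normal(3) by simp
  next
    case degenerate
    have "integrable M (\<lambda>\<omega>. (L \<omega>)\<^sup>2) \<longleftrightarrow> integrable M (\<lambda>\<omega>. 0 :: real)"
      by (intro integrable_cong_AE) (use degenerate in auto)
    moreover have "expectation (\<lambda>\<omega>. (L \<omega>)\<^sup>2) = expectation (\<lambda>\<omega>. 0)"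
      by (intro integral_cong_AE) (use degenerate in auto)
    moreover have "expectation (\<lambda>\<omega>. iexp (L \<omega>)) = expectation (\<lambda>\<omega>. 1)"
      by (intro integral_cong_AE) (use degenerate in auto)
    ultimately show ?thesis by (simp add: prob_space)
  qed
  then show "integrable M (\<lambda>\<omega>. (L \<omega>)\<^sup>2)"
    "expectation (\<lambda>\<omega>. iexp (L \<omega>)) = exp (- expectation (\<lambda>\<omega>. (L \<omega>)\<^sup>2) / 2)" by auto
qed

text \<open>Orthogonality removes the cross term from the variance of \<open>s * R \<omega>\<close>
  plus a combination of the \<open>T p\<close>. Variances add, so characteristic functions multiply,
  and independence follows from \<open>indep_if_char_factors\<close>.\<close>

lemma (in prob_space) jointly_gaussian_residual_indep:
  fixes T :: "'i \<Rightarrow> 'a \<Rightarrow> real"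
  assumes gauss: "jointly_gaussian M I T" and centered: "\<And>i. i \<in> I \<Longrightarrow> expectation (T i) = 0"
    and G: "finite G" "G \<subseteq> I" and k: "k \<in> I" "k \<notin> G"
    and orth: "\<And>q. q \<in> G \<Longrightarrow> expectation (\<lambda>\<omega>. (T k \<omega> - (\<Sum>p\<in>G. a p * T p \<omega>)) * T q \<omega>) = 0"
  shows "distr M (borel \<Otimes>\<^sub>M PiM G (\<lambda>_. borel)) (\<lambda>\<omega>. (T k \<omega> - (\<Sum>p\<in>G. a p * T p \<omega>), \<lambda>p\<in>G. T p \<omega>))
    = distr M borel (\<lambda>\<omega>. T k \<omega> - (\<Sum>p\<in>G. a p * T p \<omega>)) \<Otimes>\<^sub>M distr M (PiM G (\<lambda>_. borel)) (\<lambda>\<omega>. \<lambda>p\<in>G. T p \<omega>)"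
    and "gaussian_rv M (\<lambda>\<omega>. T k \<omega> - (\<Sum>p\<in>G. a p * T p \<omega>))"
    and "expectation (\<lambda>\<omega>. T k \<omega> - (\<Sum>p\<in>G. a p * T p \<omega>)) = 0"
proof -
  define R where "R \<omega> = T k \<omega> - (\<Sum>p\<in>G. a p * T p \<omega>)" for \<omega>
  have gT: "gaussian_rv M (T i)" if "i \<in> I" for i
    using gauss[unfolded jointly_gaussian_def, rule_format, of "{i}" "\<lambda>_. 1"] that by simp
  have sT: "square_integrable M (T i)" if "i \<in> I" for i
    using gT[OF that] centered[OF that] square_integrable_centered_gaussian
    by (auto simp: square_integrable_def gaussian_rv_def)
  have iT: "integrable M (T i)" if "i \<in> I" for i
    using sT[OF that] by (auto simp: square_integrable_def intro: square_integrable_imp_integrable)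
  \<comment> \<open>Collecting coefficients gives a single combination over
    \<open>insert k G\<close>, the form to which joint Gaussianity applies.\<close>
  have comb: "s * R \<omega> + (\<Sum>p\<in>G. u p * T p \<omega>)
      = (\<Sum>p\<in>insert k G. (if p = k then s else u p - s * a p) * T p \<omega>)" for s u \<omega>
  proof -
    have "(\<Sum>p\<in>G. (if p = k then s else u p - s * a p) * T p \<omega>) = (\<Sum>p\<in>G. u p * T p \<omega> - s * (a p * T p \<omega>))"
      using k by (intro sum.cong) (auto simp: algebra_simps)
    then show ?thesis using k G
      by (simp add: R_def sum_subtractf sum_distrib_left right_diff_distrib)
  qed
  have gL: "gaussian_rv M (\<lambda>\<omega>. s * R \<omega> + (\<Sum>p\<in>G. u p * T p \<omega>))" for s u
    unfolding comb by (intro gauss[unfolded jointly_gaussian_def, rule_format]) (use G k in auto)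
  have eL: "expectation (\<lambda>\<omega>. s * R \<omega> + (\<Sum>p\<in>G. u p * T p \<omega>)) = 0" for s u
    unfolding comb using iT centered G k by (subst Bochner_Integration.integral_sum) (auto intro!: sum.neutral)
  have gR: "gaussian_rv M (\<lambda>\<omega>. s * R \<omega>)" and eR: "expectation (\<lambda>\<omega>. s * R \<omega>) = 0" for s
    using gL[of s "\<lambda>_. 0"] eL[of s "\<lambda>_. 0"] by simp_all
  have gV: "gaussian_rv M (\<lambda>\<omega>. \<Sum>p\<in>G. u p * T p \<omega>)" and eV: "expectation (\<lambda>\<omega>. \<Sum>p\<in>G. u p * T p \<omega>) = 0" for u
    using gL[of 0 u] eL[of 0 u] by simp_all
  have sR: "square_integrable M R"
    using gR[of 1] eR[of 1] square_integrable_centered_gaussian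
    by (auto simp: square_integrable_def gaussian_rv_def)
  have sV: "square_integrable M (\<lambda>\<omega>. \<Sum>p\<in>G. u p * T p \<omega>)" for u
    using G by (intro square_integrable_sum sT) auto
  have cross: "expectation (\<lambda>\<omega>. R \<omega> * (\<Sum>p\<in>G. u p * T p \<omega>)) = 0" for u
  proof -
    have "expectation (\<lambda>\<omega>. R \<omega> * (\<Sum>p\<in>G. u p * T p \<omega>)) = expectation (\<lambda>\<omega>. \<Sum>p\<in>G. u p * (R \<omega> * T p \<omega>))"
      by (simp add: sum_distrib_left mult.left_commute)
    also have "\<dots> = (\<Sum>p\<in>G. u p * expectation (\<lambda>\<omega>. R \<omega> * T p \<omega>))"
      using G square_integrable_mult[OF sR sT] by (subst Bochner_Integration.integral_sum) auto
    also have "\<dots> = 0" using orth by (simp add: R_def)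
    finally show ?thesis .
  qed
  have "distr M (borel \<Otimes>\<^sub>M PiM G (\<lambda>_. borel)) (\<lambda>\<omega>. (R \<omega>, \<lambda>p\<in>G. T p \<omega>))
      = distr M borel R \<Otimes>\<^sub>M distr M (PiM G (\<lambda>_. borel)) (\<lambda>\<omega>. \<lambda>p\<in>G. T p \<omega>)"
  proof (rule indep_if_char_factors[OF G(1)])
    show "R \<in> borel_measurable M" using sR by (simp add: square_integrable_def)
    show "T p \<in> borel_measurable M" if "p \<in> G" for p
      using sT[of p] that G by (auto simp: square_integrable_def)
    fix s u
    let ?U = "\<lambda>\<omega>. \<Sum>p\<in>G. u p * T p \<omega>"
    have sU: "square_integrable M ?U" and ssR: "square_integrable M (\<lambda>\<omega>. s * R \<omega>)"
      using sV square_integrable_cmult[OF sR] by auto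
    have "expectation (\<lambda>\<omega>. (s * R \<omega> + ?U \<omega>)\<^sup>2)
        = expectation (\<lambda>\<omega>. (s * R \<omega>)\<^sup>2 + (?U \<omega>)\<^sup>2 + (2 * s) * (R \<omega> * ?U \<omega>))"
      by (simp add: power2_sum mult.assoc)
    also have "\<dots> = expectation (\<lambda>\<omega>. (s * R \<omega>)\<^sup>2) + expectation (\<lambda>\<omega>. (?U \<omega>)\<^sup>2)
        + 2 * s * expectation (\<lambda>\<omega>. R \<omega> * ?U \<omega>)"
    proof -
      have i1: "integrable M (\<lambda>\<omega>. (s * R \<omega>)\<^sup>2)" "integrable M (\<lambda>\<omega>. (?U \<omega>)\<^sup>2)"
        using sU ssR by (simp_all only: square_integrable_def)
      have i2: "integrable M (\<lambda>\<omega>. (2 * s) * (R \<omega> * ?U \<omega>))"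
        by (intro integrable_mult_right square_integrable_mult sR sU)
      show ?thesis
        by (simp only: Bochner_Integration.integral_add[OF Bochner_Integration.integrable_add[OF i1] i2]
            Bochner_Integration.integral_add[OF i1] integral_mult_right_zero)
    qed
    finally have var: "expectation (\<lambda>\<omega>. (s * R \<omega> + ?U \<omega>)\<^sup>2)
        = expectation (\<lambda>\<omega>. (s * R \<omega>)\<^sup>2) + expectation (\<lambda>\<omega>. (?U \<omega>)\<^sup>2)"
      by (simp only: cross mult_zero_right add_0_right)
    show "expectation (\<lambda>\<omega>. iexp (s * R \<omega> + ?U \<omega>))
        = expectation (\<lambda>\<omega>. iexp (s * R \<omega>)) * expectation (\<lambda>\<omega>. iexp (?U \<omega>))"
      unfolding char_centered_gaussian[OF gL eL] char_centered_gaussian[OF gR eR]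
        char_centered_gaussian[OF gV eV] var
      by (simp only: of_real_mult[symmetric] exp_add[symmetric] minus_add_distrib add_divide_distrib diff_conv_add_uminus)
  qed
  then show "distr M (borel \<Otimes>\<^sub>M PiM G (\<lambda>_. borel)) (\<lambda>\<omega>. (T k \<omega> - (\<Sum>p\<in>G. a p * T p \<omega>), \<lambda>p\<in>G. T p \<omega>))
    = distr M borel (\<lambda>\<omega>. T k \<omega> - (\<Sum>p\<in>G. a p * T p \<omega>)) \<Otimes>\<^sub>M distr M (PiM G (\<lambda>_. borel)) (\<lambda>\<omega>. \<lambda>p\<in>G. T p \<omega>)"
    by (simp only: R_def[abs_def])
  show "gaussian_rv M (\<lambda>\<omega>. T k \<omega> - (\<Sum>p\<in>G. a p * T p \<omega>))"
    "expectation (\<lambda>\<omega>. T k \<omega> - (\<Sum>p\<in>G. a p * T p \<omega>)) = 0"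
    using gR[of 1] eR[of 1] by (simp_all add: R_def)
qed

subsection \<open>Determinants\<close>

text \<open>Deleting row \<open>m\<close> removes the only position where the matrices may differ,
  so all cofactors along that row agree. Expanding both determinants there leaves just the corner
  term of \<open>A\<close>.\<close>

lemma det_corner_entry:
  fixes A :: "'a :: comm_ring_1 mat"
  assumes A: "A \<in> carrier_mat (Suc m) (Suc m)" and B: "B \<in> carrier_mat (Suc m) (Suc m)"
    and eq: "\<And>i j. i < Suc m \<Longrightarrow> j < Suc m \<Longrightarrow> (i, j) \<noteq> (m, m) \<Longrightarrow> A $$ (i, j) = B $$ (i, j)"
    and 0: "B $$ (m, m) = 0"
  shows "det A = A $$ (m, m) * det (mat_delete A m m) + det B"
proof -
  have del: "mat_delete A m j = mat_delete B m j" for j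
    using A B unfolding mat_delete_def by (intro cong_mat) (auto intro!: eq)
  have "det A = (\<Sum>j<m. A $$ (m, j) * cofactor A m j) + A $$ (m, m) * cofactor A m m"
    by (subst laplace_expansion_row[OF A, of m]) auto
  also have "(\<Sum>j<m. A $$ (m, j) * cofactor A m j) = (\<Sum>j<m. B $$ (m, j) * cofactor B m j)"
    by (intro sum.cong) (auto simp: cofactor_def del eq)
  also have "\<dots> = det B"
    by (subst laplace_expansion_row[OF B, of m]) (auto simp: 0)
  finally show ?thesis by (simp add: cofactor_def)
qed

lemma borel_measurable_det:
  fixes f :: "nat \<Rightarrow> nat \<Rightarrow> 'a \<Rightarrow> real"
  assumes [measurable]: "\<And>i j. i < n \<Longrightarrow> j < n \<Longrightarrow> f i j \<in> borel_measurable M"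
  shows "(\<lambda>\<omega>. det (mat n n (\<lambda>(i, j). f i j \<omega>))) \<in> borel_measurable M"
proof -
  have "(\<lambda>\<omega>. det (mat n n (\<lambda>(i, j). f i j \<omega>)))
      = (\<lambda>\<omega>. \<Sum>p | p permutes {0..<n}. signof p * (\<Prod>i = 0..<n. f i (p i) \<omega>))"
  proof
    fix \<omega>
    have "p i < n" if "p permutes {0..<n}" "i < n" for p i
      using permutes_in_image[OF that(1), of i] that(2) by simp
    then show "det (mat n n (\<lambda>(i, j). f i j \<omega>))
        = (\<Sum>p | p permutes {0..<n}. signof p * (\<Prod>i = 0..<n. f i (p i) \<omega>))"
      by (subst det_def'[of _ n]) (auto intro!: sum.cong prod.cong)
  qed
  also have "\<dots> \<in> borel_measurable M"
  proof (intro borel_measurable_sum borel_measurable_times borel_measurable_prod)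
    fix p i assume "p \<in> {p. p permutes {0..<n}}" "i \<in> {0..<n}"
    then have "p i < n" "i < n" using permutes_in_image[of p "{0..<n}" i] by auto
    then show "f i (p i) \<in> borel_measurable M" by simp
  qed simp
  finally show ?thesis .
qed

subsection \<open>The determinant of a Gaussian array\<close>

text \<open>Every finite combination competes in the infimum. A fixed set \<open>G\<close> replaces
  the support, so the projection coefficients may vanish at some elements of
  \<open>G\<close>.\<close>

lemma residual_variance_le:
  assumes G: "finite G" "G \<subseteq> {(i, j) \<in> array_idx. min i j < k}"
  shows "residual_variance M \<tau> k \<le> (\<integral>\<omega>. (\<tau> k k \<omega> - (\<Sum>(i, j)\<in>G. a (i, j) * \<tau> i j \<omega>))\<^sup>2 \<partial>M)"
proof -
  \<comment> \<open>Truncation outside \<open>G\<close> makes the support finite and admissible,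
    whatever values \<open>a\<close> takes there.\<close>
  define b where "b p = (if p \<in> G then a p else 0)" for p
  have sub: "{p. b p \<noteq> 0} \<subseteq> G" by (auto simp: b_def)
  then have b: "b \<in> coeff_families k"
    using G finite_subset unfolding coeff_families_def by blast
  have eq: "(\<Sum>(i, j)\<in>{p. b p \<noteq> 0}. b (i, j) * \<tau> i j \<omega>) = (\<Sum>(i, j)\<in>G. a (i, j) * \<tau> i j \<omega>)" for \<omega>
  proof -
    have "(\<Sum>(i, j)\<in>{p. b p \<noteq> 0}. b (i, j) * \<tau> i j \<omega>) = (\<Sum>(i, j)\<in>G. b (i, j) * \<tau> i j \<omega>)"
      using G sub by (intro sum.mono_neutral_left) auto
    also have "\<dots> = (\<Sum>(i, j)\<in>G. a (i, j) * \<tau> i j \<omega>)"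
      by (intro sum.cong) (auto simp: b_def)
    finally show ?thesis .
  qed
  have "residual_variance M \<tau> k \<le> (\<integral>\<omega>. (\<tau> k k \<omega> - (\<Sum>(i, j)\<in>{p. b p \<noteq> 0}. b (i, j) * \<tau> i j \<omega>))\<^sup>2 \<partial>M)"
    unfolding residual_variance_def
    by (rule cINF_lower[OF _ b]) (auto intro!: bdd_belowI[of _ 0])
  then show ?thesis unfolding eq .
qed

theorem theorem1p1:
  fixes M :: "'a measure" and \<tau> :: "nat \<Rightarrow> nat \<Rightarrow> 'a \<Rightarrow> real"
    and N :: "'b measure" and X :: "nat \<Rightarrow> 'b \<Rightarrow> real"
    and n :: nat and \<epsilon> :: real
  assumes "prob_space M"
    and "jointly_gaussian M array_idx (\<lambda>(i, j). \<tau> i j)"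
    and "\<And>i j. 1 \<le> i \<Longrightarrow> 1 \<le> j \<Longrightarrow> (\<integral>\<omega>. \<tau> i j \<omega> \<partial>M) = 0"
    and "\<And>k. 1 \<le> k \<Longrightarrow> residual_variance M \<tau> k = 1"
    and "prob_space N"
    and "prob_space.indep_vars N (\<lambda>_. borel) X {1..n}"
    and "\<And>j. j \<in> {1..n} \<Longrightarrow> distributed N lborel (X j) std_normal_density"
    and "1 \<le> n" and "0 < \<epsilon>"
  shows "measure M {\<omega> \<in> space M. \<bar>det_array \<tau> n \<omega>\<bar> \<le> \<epsilon>}
       \<le> measure N {\<omega> \<in> space N. (\<Prod>j = 1..n. \<bar>X j \<omega>\<bar>) \<le> \<epsilon>}"
proof -
  interpret prob_space M by fact
  interpret N: prob_space N by fact
  define T :: "nat \<times> nat \<Rightarrow> 'a \<Rightarrow> real" where "T = (\<lambda>(i, j). \<tau> i j)"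
  have T[simp]: "T (i, j) = \<tau> i j" for i j by (simp add: T_def)
  have gauss: "jointly_gaussian M array_idx T" using assms(2) by (simp add: T_def)
  have centered: "expectation (T p) = 0" if "p \<in> array_idx" for p
    using assms(3) that by (auto simp: array_idx_def)
  have sT: "square_integrable M (T p)" if "p \<in> array_idx" for p
  proof -
    have "gaussian_rv M (T p)"
      using gauss[unfolded jointly_gaussian_def, rule_format, of "{p}" "\<lambda>_. 1"] that by simp
    then show ?thesis
      using centered[OF that] square_integrable_centered_gaussian
      by (auto simp: square_integrable_def gaussian_rv_def)
  qed
  \<comment> \<open>The threshold \<open>e\<close> is generalised because the induction step
    rescales it by \<open>\<bar>r\<bar>\<close>.\<close>
  have "emeasure M {\<omega>\<in>space M. \<bar>det_array \<tau> m \<omega>\<bar> \<le> e} \<le> emeasure N {\<omega>\<in>space N. (\<Prod>j = 1..m. \<bar>X j \<omega>\<bar>) \<le> e}"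
    if "m \<le> n" "0 < e" for m e
    using that
  proof (induction m arbitrary: e)
    case 0
    \<comment> \<open>The empty determinant and the empty product are both 1, so both events are
      certain or both are impossible.\<close>
    then show ?case
      by (cases "1 \<le> e") (simp_all add: det_array_def det_dim_zero emeasure_space_1 N.emeasure_space_1)
  next
    case (Suc m)
    let ?k = "(Suc m, Suc m)"
    define G where "G = {1..Suc m} \<times> {1..Suc m} - {?k}"
    define P where "P = PiM G (\<lambda>_. borel :: real measure)"
    have G: "finite G" "G \<subseteq> array_idx" and k: "?k \<in> array_idx" "?k \<notin> G"
      by (auto simp: G_def array_idx_def)
    obtain a where a: "\<And>q. q \<in> G \<Longrightarrow> expectation (\<lambda>\<omega>. (T ?k \<omega> - (\<Sum>p\<in>G. a p * T p \<omega>)) * T q \<omega>) = 0"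
      using orthogonal_residual_exists[of G M T "T ?k"] G k sT by blast
    define R where "R \<omega> = T ?k \<omega> - (\<Sum>p\<in>G. a p * T p \<omega>)" for \<omega>
    define V where "V \<omega> = (\<lambda>p\<in>G. T p \<omega>)" for \<omega>
    note res = jointly_gaussian_residual_indep[OF gauss centered G k a]
    have joint: "distr M (borel \<Otimes>\<^sub>M P) (\<lambda>\<omega>. (R \<omega>, V \<omega>)) = distr M borel R \<Otimes>\<^sub>M distr M P V"
      using res(1) unfolding R_def[abs_def] V_def[abs_def] P_def by simp
    have gR: "gaussian_rv M R" "expectation R = 0"
      using res(2,3) unfolding R_def[abs_def] by simp_all
    \<comment> \<open>Within the block only the corner has both indices equal to
      \<open>Suc m\<close>, so the projection onto the entries in \<open>G\<close> is a competitor
      in the residual variance at \<open>Suc m\<close>.\<close>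
    have "G \<subseteq> {(i, j) \<in> array_idx. min i j < Suc m}"
      by (auto simp: G_def array_idx_def)
    from residual_variance_le[OF G(1) this, of M \<tau> a] assms(4)[of "Suc m"]
    have varR: "1 \<le> expectation (\<lambda>\<omega>. (R \<omega>)\<^sup>2)"
      by (simp add: R_def T_def split_def)
    \<comment> \<open>Second moment at least 1 rules out the degenerate law and bounds the standard
      deviation from below.\<close>
    obtain \<sigma> where \<sigma>: "1 \<le> \<sigma>" and normal: "distributed M lborel R (normal_density 0 \<sigma>)"
      using gR
    proof (cases rule: centered_gaussian_cases)
      case (normal \<sigma>)
      then have "1\<^sup>2 \<le> \<sigma>\<^sup>2" using varR by simp
      then have "1 \<le> \<sigma>" using normal(1) by (intro power2_le_imp_le[of 1 \<sigma>]) auto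
      with normal show ?thesis by (intro that)
    next
      case degenerate
      then have "AE \<omega> in M. (R \<omega>)\<^sup>2 = 0" by auto
      then have "expectation (\<lambda>\<omega>. (R \<omega>)\<^sup>2) = 0" by (rule integral_eq_zero_AE)
      with varR show ?thesis by simp
    qed
    define d where "d v = det (mat m m (\<lambda>(i, j). v (Suc i, Suc j)))" for v :: "nat \<times> nat \<Rightarrow> real"
    \<comment> \<open>The corner is set to 0: a point of the product space over \<open>G\<close>
      carries no coordinate there.\<close>
    define B where "B v = mat (Suc m) (Suc m) (\<lambda>(i, j). if (i, j) = (m, m) then 0 else v (Suc i, Suc j))"
      for v :: "nat \<times> nat \<Rightarrow> real"
    \<comment> \<open>Writing the corner entry as \<open>R\<close> plus its projection, the
      projection times the minor joins the determinant with zero corner; both depend only on the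
      entries in \<open>G\<close>.\<close>
    define y where "y v = (\<Sum>p\<in>G. a p * v p) * d v + det (B v)" for v
    have comp: "(\<lambda>v. v (Suc i, Suc j)) \<in> borel_measurable P"
      if "i < Suc m" "j < Suc m" "(i, j) \<noteq> (m, m)" for i j
      unfolding P_def using that by (intro measurable_component_singleton) (auto simp: G_def)
    have d_meas: "d \<in> borel_measurable P"
      unfolding d_def[abs_def] by (intro borel_measurable_det comp) auto
    have "(\<lambda>v. if (i, j) = (m, m) then 0 else v (Suc i, Suc j)) \<in> borel_measurable P"
      if "i < Suc m" "j < Suc m" for i j
      using comp[OF that] by (cases "(i, j) = (m, m)") auto
    then have "(\<lambda>v. det (B v)) \<in> borel_measurable P"
      unfolding B_def by (rule borel_measurable_det)
    moreover have "(\<lambda>v. v p) \<in> borel_measurable P" if "p \<in> G" for p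
      unfolding P_def using that by (rule measurable_component_singleton)
    ultimately have y_meas: "y \<in> borel_measurable P"
      unfolding y_def[abs_def] using d_meas by measurable
    have V_meas: "V \<in> measurable M P"
      unfolding V_def[abs_def] P_def using sT G
      by (intro measurable_restrict) (auto simp: square_integrable_def)
    have dV: "d (V \<omega>) = det_array \<tau> m \<omega>" for \<omega>
      unfolding d_def det_array_def
      by (intro arg_cong[where f = det] cong_mat) (auto simp: V_def G_def)
    have det: "det_array \<tau> (Suc m) \<omega> = R \<omega> * d (V \<omega>) + y (V \<omega>)" for \<omega>
    proof -
      let ?A = "mat (Suc m) (Suc m) (\<lambda>(i, j). \<tau> (Suc i) (Suc j) \<omega>)"
      have "det ?A = ?A $$ (m, m) * det (mat_delete ?A m m) + det (B (V \<omega>))"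
        by (rule det_corner_entry[of _ m]) (auto simp: B_def V_def G_def)
      moreover have "mat_delete ?A m m = mat m m (\<lambda>(i, j). \<tau> (Suc i) (Suc j) \<omega>)"
        unfolding mat_delete_def by (intro cong_mat) auto
      moreover have "(\<Sum>p\<in>G. a p * V \<omega> p) = (\<Sum>p\<in>G. a p * T p \<omega>)"
        by (intro sum.cong) (auto simp: V_def)
      ultimately show ?thesis
        by (simp add: dV y_def R_def det_array_def algebra_simps)
    qed
    have "emeasure M {\<omega>\<in>space M. \<bar>det_array \<tau> (Suc m) \<omega>\<bar> \<le> e}
        \<le> (\<integral>\<^sup>+r. emeasure M {\<omega>\<in>space M. \<bar>r\<bar> * \<bar>d (V \<omega>)\<bar> \<le> e} \<partial>std_normal_distribution)"
      unfolding det using Suc.prems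
      by (intro normal_affine_small_ball[OF normal V_meas d_meas y_meas joint \<sigma>]) auto
    also have "\<dots> \<le> (\<integral>\<^sup>+r. emeasure N {\<omega>\<in>space N. \<bar>r\<bar> * (\<Prod>j = 1..m. \<bar>X j \<omega>\<bar>) \<le> e} \<partial>std_normal_distribution)"
    proof (rule nn_integral_mono)
      fix r :: real
      show "emeasure M {\<omega>\<in>space M. \<bar>r\<bar> * \<bar>d (V \<omega>)\<bar> \<le> e}
          \<le> emeasure N {\<omega>\<in>space N. \<bar>r\<bar> * (\<Prod>j = 1..m. \<bar>X j \<omega>\<bar>) \<le> e}"
      \<comment> \<open>For \<open>r = 0\<close> both events are certain, as \<open>e\<close> is
        positive. Otherwise dividing by \<open>\<bar>r\<bar>\<close> leads to the induction
        hypothesis at \<open>e / \<bar>r\<bar>\<close>.\<close>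
      proof (cases "r = 0")
        case True
        then show ?thesis using Suc.prems by (simp add: emeasure_space_1 N.emeasure_space_1)
      next
        case False
        then have "\<bar>r\<bar> * x \<le> e \<longleftrightarrow> x \<le> e / \<bar>r\<bar>" for x by (simp add: field_simps)
        then show ?thesis
          using Suc.IH[of "e / \<bar>r\<bar>"] Suc.prems False by (simp only: dV) simp
      qed
    qed
    also have "\<dots> = emeasure N {\<omega>\<in>space N. (\<Prod>j = 1..Suc m. \<bar>X j \<omega>\<bar>) \<le> e}"
    proof (rule N.emeasure_prod_std_normal_Suc[symmetric])
      show "N.indep_vars (\<lambda>_. borel) X {1..Suc m}"
        using Suc.prems by (intro N.indep_vars_subset[OF assms(6)]) simp
      show "distributed N lborel (X (Suc m)) std_normal_density"
        using Suc.prems by (intro assms(7)) simp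
    qed
    finally show ?case .
  qed
  from this[of n \<epsilon>] show ?thesis
    using \<open>0 < \<epsilon>\<close> by (simp add: emeasure_eq_measure N.emeasure_eq_measure)
qed

end
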